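(* For every positive integer $n$, \[ 2B(n) - W(n) \;=\; n - 1 - F(n). \]
   Context: $\lg$ is the logarithm to base 2. For a real number $x$, $\mathrm{Zigzag}(x) = \min\left(x - \lfloor x \rfloor,\ \lceil x \rceil - x\right)$. $B$ is the function on positive integers defined by $B(1) = 0$ and, for $n \ge 2$, $B(n) = \lfloor n/2 \rfloor + B(\lfloor n/2 \rfloor) + B(\lceil n/2 \rceil)$ (the minimum number of key comparisons of MergeSort on $n$ elements). $W(n) = \sum_{i=1}^{n} \lceil \lg i \rceil$ (the maximum number of key comparisons of MergeSort on $n$ elements). $F(n) = \sum_{k=1}^{\lfloor \lg n \rfloor} 2^k\, \mathrm{Zigzag}\!\left(\frac{n}{2^k}\right)$. *)

theory Defs
  imports Complex_Main
begin

definition zigzag :: "real \<Rightarrow> real" where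
  "zigzag x = min (x - of_int \<lfloor>x\<rfloor>) (of_int \<lceil>x\<rceil> - x)"

(* The function B: minimum number of key comparisons of MergeSort on n elements.
   Here n div 2 is the floor and (n + 1) div 2 the ceiling of n / 2.
   The value at 0 is outside the domain of B; it is set to 0. *)
fun mergesort_min :: "nat \<Rightarrow> nat" where
  "mergesort_min n =
     (if n \<le> 1 then 0
      else n div 2 + mergesort_min (n div 2) + mergesort_min ((n + 1) div 2))"

declare mergesort_min.simps [simp del]

lemma mergesort_min_1: "mergesort_min 1 = 0"
  by (simp add: mergesort_min.simps)

lemma mergesort_min_rec:
  assumes "n \<ge> 2"
  shows "mergesort_min n =
    nat \<lfloor>real n / 2\<rfloor> + mergesort_min (nat \<lfloor>real n / 2\<rfloor>) + mergesort_min (nat \<lceil>real n / 2\<rceil>)"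
proof -
  have "nat \<lfloor>real n / 2\<rfloor> = n div 2"
    by linarith
  moreover have "nat \<lceil>real n / 2\<rceil> = (n + 1) div 2"
    by linarith
  ultimately show ?thesis
    using assms by (simp add: mergesort_min.simps [of n])
qed

(* The function W: maximum number of key comparisons of MergeSort on n elements. *)
definition mergesort_max :: "nat \<Rightarrow> int" where
  "mergesort_max n = (\<Sum>i=1..n. \<lceil>log 2 (real i)\<rceil>)"

(* The function F. For n \<ge> 1 the floor of log 2 n is nonnegative, so nat truncates nothing. *)
definition zigzag_sum :: "nat \<Rightarrow> real" where
  "zigzag_sum n = (\<Sum>k=1..nat \<lfloor>log 2 (real n)\<rfloor>. 2 ^ k * zigzag (real n / 2 ^ k))"

end

theory Submission
  imports Defs
begin

text \<open>
  Both sides satisfy the same divide-and-conquer recurrence: the left-hand side by the recurrences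
  for \<open>B\<close> and \<open>W\<close>, the right-hand side because \<open>F(n) = F(\<lfloor>n/2\<rfloor>) + F(\<lceil>n/2\<rceil>) + (n mod 2)\<close>.
  The latter holds since, for \<open>k \<ge> 1\<close>, the function \<open>x \<mapsto> 2\<^sup>k Zigzag(x/2\<^sup>k)\<close> is affine on each
  interval \<open>[m, m + 1]\<close>, so its value at the midpoint is the mean of the values at the endpoints.
\<close>

text \<open>The closed range of \<open>t\<close> matters: \<open>t = 1\<close> occurs when a right
  endpoint is an integer but is still written relative to the integer on its left.\<close>

lemma zigzag_add_of_nat:
  assumes "0 \<le> t" "t \<le> 1"
  shows "zigzag (real q + t) = min t (1 - t)"
proof -
  consider "t = 0" | "0 < t" "t < 1" | "t = 1"
    using assms by linarith
  then show ?thesis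
  proof cases
    case 2
    then have "\<lfloor>real q + t\<rfloor> = int q" "\<lceil>real q + t\<rceil> = int q + 1"
      by linarith+
    then show ?thesis
      by (simp add: zigzag_def min_def)
  qed (auto simp: zigzag_def)
qed

lemma zigzag_of_nat [simp]: "zigzag (real q) = 0"
  by (simp add: zigzag_def)

lemma zigzag_of_nat_add_half: "zigzag (real m + 1 / 2) = 1 / 2"
  by (simp add: zigzag_add_of_nat)

text \<open>The slope of Zigzag changes only at multiples of 1/2. With the even denominator
  \<open>2 * e\<close> these correspond to multiples of \<open>e\<close>, and none lies strictly
  between \<open>m\<close> and \<open>m + 1\<close>.\<close>

lemma zigzag_midpoint:
  assumes "e > 0"
  shows "2 * zigzag ((2 * real m + 1) / (4 * real e)) =
    zigzag (real m / (2 * real e)) + zigzag ((real m + 1) / (2 * real e))"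
proof -
  define q r where "q = m div (2 * e)" and "r = m mod (2 * e)"
  have "m = 2 * e * q + r"
    by (simp add: q_def r_def)
  then have m: "real m = 2 * real e * real q + real r"
    by (metis of_nat_add of_nat_mult of_nat_numeral)
  have "r < 2 * e"
    using assms by (simp add: r_def)
  \<comment> \<open>By integrality, both endpoints lie in the same closed interval from
    \<open>q\<close> to \<open>q + 1\<close>.\<close>
  then have r: "real r + 1 \<le> 2 * real e"
    by linarith
  have split:
    "(2 * real m + 1) / (4 * real e) = real q + (2 * real r + 1) / (4 * real e)"
    "real m / (2 * real e) = real q + real r / (2 * real e)"
    "(real m + 1) / (2 * real e) = real q + (real r + 1) / (2 * real e)"
    using assms by (simp_all add: m field_simps)
  have zigzags:
    "zigzag ((2 * real m + 1) / (4 * real e)) =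
      min ((2 * real r + 1) / (4 * real e)) (1 - (2 * real r + 1) / (4 * real e))"
    "zigzag (real m / (2 * real e)) = min (real r / (2 * real e)) (1 - real r / (2 * real e))"
    "zigzag ((real m + 1) / (2 * real e)) =
      min ((real r + 1) / (2 * real e)) (1 - (real r + 1) / (2 * real e))"
    unfolding split using assms r by (intro zigzag_add_of_nat; simp add: field_simps)+
  have min_le_half: "min t (1 - t) = t" if "t \<le> 1 / 2" for t :: real
    using that by simp
  have min_ge_half: "min t (1 - t) = 1 - t" if "t \<ge> 1 / 2" for t :: real
    using that by simp
  show ?thesis
  \<comment> \<open>All three points lie on the rising branch if \<open>r < e\<close>, and on the
    falling branch otherwise.\<close>
  proof (cases "r < e")
    case True
    then have "real r + 1 \<le> real e"
      by linarith
    then have "(2 * real r + 1) / (4 * real e) \<le> 1 / 2"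
      "real r / (2 * real e) \<le> 1 / 2"
      "(real r + 1) / (2 * real e) \<le> 1 / 2"
      using assms by (simp_all add: field_simps)
    then show ?thesis
      by (simp only: zigzags min_le_half) (use assms in \<open>simp add: field_simps\<close>)
  next
    case False
    then have "real e \<le> real r"
      by linarith
    then have "(2 * real r + 1) / (4 * real e) \<ge> 1 / 2"
      "real r / (2 * real e) \<ge> 1 / 2"
      "(real r + 1) / (2 * real e) \<ge> 1 / 2"
      using assms by (simp_all add: field_simps)
    then show ?thesis
      by (simp only: zigzags min_ge_half) (use assms in \<open>simp add: field_simps\<close>)
  qed
qed

lemma nat_floor_log2_double:
  assumes "m \<ge> 1"
  shows "nat \<lfloor>log 2 (real (2 * m))\<rfloor> = Suc (nat \<lfloor>log 2 (real m)\<rfloor>)"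
    and "nat \<lfloor>log 2 (real (2 * m + 1))\<rfloor> = Suc (nat \<lfloor>log 2 (real m)\<rfloor>)"
proof -
  have "0 \<le> \<lfloor>log 2 (real m)\<rfloor>"
    using assms by simp
  then show "nat \<lfloor>log 2 (real (2 * m))\<rfloor> = Suc (nat \<lfloor>log 2 (real m)\<rfloor>)"
    and "nat \<lfloor>log 2 (real (2 * m + 1))\<rfloor> = Suc (nat \<lfloor>log 2 (real m)\<rfloor>)"
    using floor_log2_div2[of "2 * m"] floor_log2_div2[of "2 * m + 1"] assms
    by (simp_all add: nat_add_distrib)
qed

text \<open>When \<open>\<lfloor>lg (m + 1)\<rfloor>\<close> exceeds \<open>\<lfloor>lg m\<rfloor>\<close>, the number \<open>m + 1\<close> is a power of two and the
  additional summand of \<open>F(m + 1)\<close> vanishes.\<close>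
lemma zigzag_sum_Suc:
  assumes "m \<ge> 1"
  shows "zigzag_sum (Suc m) =
    (\<Sum>k=1..nat \<lfloor>log 2 (real m)\<rfloor>. 2 ^ k * zigzag (real (Suc m) / 2 ^ k))"
proof -
  define l p where "l = nat \<lfloor>log 2 (real m)\<rfloor>" and "p = nat \<lfloor>log 2 (real (Suc m))\<rfloor>"
  have "l \<le> p"
    unfolding l_def p_def using assms by (intro nat_mono floor_mono) simp
  \<comment> \<open>As \<open>m + 1 \<le> 2 * m\<close>, the floor of the logarithm grows by at most
    1.\<close>
  have "p \<le> nat \<lfloor>log 2 (real (2 * m))\<rfloor>"
    unfolding p_def using assms by (intro nat_mono floor_mono) simp
  then have "p \<le> Suc l"
    using nat_floor_log2_double(1)[OF assms] by (simp add: l_def)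
  with \<open>l \<le> p\<close> consider "p = l" | "p = Suc l"
    by linarith
  then show ?thesis
  proof cases
    case 1
    then show ?thesis
      by (simp add: zigzag_sum_def l_def p_def)
  next
    case 2
    have "0 \<le> \<lfloor>log 2 (real m)\<rfloor>" "0 \<le> \<lfloor>log 2 (real (Suc m))\<rfloor>"
      using assms by simp_all
    then have l: "\<lfloor>log 2 (real m)\<rfloor> = int l" and p: "\<lfloor>log 2 (real (Suc m))\<rfloor> = int p"
      unfolding l_def p_def by linarith+
    have "m < 2 ^ p"
      using floor_log_nat_eq_powr_iff[of 2 m l] assms l 2 by simp
    moreover have "2 ^ p \<le> Suc m"
      using floor_log_nat_eq_powr_iff[of 2 "Suc m" p] p by simp
    ultimately have "real (Suc m) = 2 ^ p"
      by (metis le_antisym Suc_leI of_nat_numeral of_nat_power)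
    then have "real (Suc m) / 2 ^ p = real 1"
      by simp
    then have "zigzag (real (Suc m) / 2 ^ p) = 0"
      by (simp only: zigzag_of_nat)
    moreover have "zigzag_sum (Suc m) = (\<Sum>k=1..p. 2 ^ k * zigzag (real (Suc m) / 2 ^ k))"
      by (simp only: zigzag_sum_def p_def)
    ultimately show ?thesis
      by (simp add: 2 flip: l_def)
  qed
qed

lemma sum_from_1_Suc: "(\<Sum>k=1..Suc l. f k) = f 1 + (\<Sum>k=1..l. f (Suc k))"
  for f :: "nat \<Rightarrow> 'a::comm_monoid_add"
  by (induction l) (simp_all add: add.assoc)

text \<open>The summand for \<open>k = 1\<close> is Zigzag at an integer and vanishes; an index
  shift doubles each remaining weight.\<close>

lemma zigzag_sum_double:
  assumes "m \<ge> 1"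
  shows "zigzag_sum (2 * m) = 2 * zigzag_sum m"
proof -
  define l where "l = nat \<lfloor>log 2 (real m)\<rfloor>"
  have "zigzag_sum (2 * m) = (\<Sum>k=1..Suc l. 2 ^ k * zigzag (real (2 * m) / 2 ^ k))"
    unfolding zigzag_sum_def nat_floor_log2_double(1)[OF assms] l_def ..
  also have "\<dots> = 2 * zigzag (real m) +
      (\<Sum>k=1..l. 2 ^ Suc k * zigzag (real (2 * m) / 2 ^ Suc k))"
    unfolding sum_from_1_Suc by simp
  also have "\<dots> = 2 * zigzag_sum m"
    by (simp add: zigzag_sum_def l_def sum_distrib_left mult.assoc)
  finally show ?thesis .
qed

lemma zigzag_sum_double_Suc:
  assumes "m \<ge> 1"
  shows "zigzag_sum (2 * m + 1) = zigzag_sum m + zigzag_sum (Suc m) + 1"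
proof -
  define l where "l = nat \<lfloor>log 2 (real m)\<rfloor>"
  have term_eq: "2 ^ Suc k * zigzag (real (2 * m + 1) / 2 ^ Suc k) =
      2 ^ k * zigzag (real m / 2 ^ k) + 2 ^ k * zigzag (real (Suc m) / 2 ^ k)"
    if "k \<in> {1..l}" for k
  proof -
    \<comment> \<open>Since \<open>k \<ge> 1\<close>, \<open>2 ^ k\<close> is twice
      \<open>2 ^ j\<close>, the even denominator that \<open>zigzag_midpoint\<close> needs.\<close>
    obtain j where "k = Suc j"
      using \<open>k \<in> {1..l}\<close> by (cases k) auto
    then have "2 * zigzag (real (2 * m + 1) / 2 ^ Suc k) =
        zigzag (real m / 2 ^ k) + zigzag (real (Suc m) / 2 ^ k)"
      using zigzag_midpoint[of "2 ^ j" m] by (simp add: add.commute)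
    then show ?thesis
      by (simp only: power_Suc2 mult.assoc distrib_left)
  qed
  have "zigzag_sum (2 * m + 1) = (\<Sum>k=1..Suc l. 2 ^ k * zigzag (real (2 * m + 1) / 2 ^ k))"
    unfolding zigzag_sum_def nat_floor_log2_double(2)[OF assms] l_def ..
  also have "\<dots> = 2 * zigzag (real m + 1 / 2) +
      (\<Sum>k=1..l. 2 ^ Suc k * zigzag (real (2 * m + 1) / 2 ^ Suc k))"
    unfolding sum_from_1_Suc by (simp add: add_divide_distrib add.commute)
  also have "\<dots> = 1 + (\<Sum>k=1..l. 2 ^ k * zigzag (real m / 2 ^ k) +
      2 ^ k * zigzag (real (Suc m) / 2 ^ k))"
    by (simp only: zigzag_of_nat_add_half sum.cong[OF refl term_eq])
  also have "\<dots> = zigzag_sum m + zigzag_sum (Suc m) + 1"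
    \<comment> \<open>Here \<open>zigzag_sum_Suc\<close> makes the sum for \<open>m + 1\<close> stop
      at the same \<open>l\<close> as the sum for \<open>m\<close>.\<close>
    unfolding zigzag_sum_Suc[OF assms] sum.distrib
    by (simp only: zigzag_sum_def l_def)
  finally show ?thesis .
qed

lemma mergesort_max_Suc: "mergesort_max (Suc n) = mergesort_max n + \<lceil>log 2 (real (Suc n))\<rceil>"
  by (simp add: mergesort_max_def)

lemma ceiling_log2_double:
  assumes "m \<ge> 1"
  shows "\<lceil>log 2 (real (2 * m))\<rceil> = \<lceil>log 2 (real m)\<rceil> + 1"
    and "\<lceil>log 2 (real (2 * m + 1))\<rceil> = \<lceil>log 2 (real (Suc m))\<rceil> + 1"
proof -
  \<comment> \<open>\<open>ceiling_log2_div2\<close> writes the half rounded up as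
    \<open>(n - 1) div 2 + 1\<close>.\<close>
  have "(2 * m - 1) div 2 + 1 = m"
    using assms by linarith
  then show "\<lceil>log 2 (real (2 * m))\<rceil> = \<lceil>log 2 (real m)\<rceil> + 1"
    using ceiling_log2_div2[of "2 * m"] assms by simp
  show "\<lceil>log 2 (real (2 * m + 1))\<rceil> = \<lceil>log 2 (real (Suc m))\<rceil> + 1"
    using ceiling_log2_div2[of "2 * m + 1"] assms by simp
qed

text \<open>The two new summands for \<open>m + 1\<close> are both
  \<open>\<lceil>log 2 (m + 1)\<rceil> + 1\<close>; the constant is fixed by W(1) = 0 and W(2) =
  1.\<close>

lemma mergesort_max_double:
  assumes "m \<ge> 1"
  shows "mergesort_max (2 * m) = 2 * mergesort_max m + 2 * int m - 1"
  using assms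
proof (induction m rule: dec_induct)
  case base
  then show ?case
    by (simp add: mergesort_max_def numeral_2_eq_2)
next
  case (step m)
  have "mergesort_max (2 * Suc m) =
      mergesort_max (2 * m) + \<lceil>log 2 (real (2 * m + 1))\<rceil> + \<lceil>log 2 (real (2 * Suc m))\<rceil>"
    using mergesort_max_Suc[of "2 * m"] mergesort_max_Suc[of "Suc (2 * m)"] by simp
  also have "\<dots> = 2 * mergesort_max (Suc m) + 2 * int (Suc m) - 1"
    unfolding ceiling_log2_double(2)[OF step.hyps(1)]
      ceiling_log2_double(1)[OF le_SucI[OF step.hyps(1)]] mergesort_max_Suc[of m] step.IH
    by simp
  finally show ?case .
qed

lemma mergesort_max_double_Suc:
  assumes "m \<ge> 1"
  shows "mergesort_max (2 * m + 1) = mergesort_max m + mergesort_max (Suc m) + 2 * int m"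
  using mergesort_max_Suc[of "2 * m"] mergesort_max_Suc[of m] mergesort_max_double[OF assms]
    ceiling_log2_double(2)[OF assms]
  by simp

theorem theorem5p1:
  fixes n :: nat
  assumes "n \<ge> 1"
  shows "2 * real (mergesort_min n) - real_of_int (mergesort_max n) = real n - 1 - zigzag_sum n"
  using assms
proof (induction n rule: less_induct)
  case (less n)
  consider "n = 1" | m where "m \<ge> 1" "n = 2 * m" | m where "m \<ge> 1" "n = 2 * m + 1"
    using less.prems by (cases "n = 1"; cases "even n") (auto elim!: evenE oddE)
  then show ?case
  proof cases
    case 1
    then show ?thesis
      by (simp add: mergesort_min_1[simplified] mergesort_max_def zigzag_sum_def)
  next
    case 2
    then have "mergesort_min n = m + 2 * mergesort_min m"
      by (simp add: mergesort_min.simps[of "2 * m"])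
    then show ?thesis
      using less.IH[of m] 2 mergesort_max_double[of m] zigzag_sum_double[of m] by simp
  next
    case 3
    then have "mergesort_min n = m + mergesort_min m + mergesort_min (Suc m)"
      by (simp add: mergesort_min.simps[of "Suc (2 * m)"])
    \<comment> \<open>The terms \<open>2 * m\<close> from 2B and W cancel. The hypothesis applies to
      \<open>Suc m\<close> because \<open>m \<ge> 1\<close> gives
      \<open>Suc m < 2 * m + 1\<close>.\<close>
    then show ?thesis
      using less.IH[of m] less.IH[of "Suc m"] 3 mergesort_max_double_Suc[of m]
        zigzag_sum_double_Suc[of m]
      by simp
  qed
qed

end
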